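(* Fix a frequency $k>0$, a constant $C_k\in\mathbb{C}\setminus\{0\}$, an integer $p\ge0$ and a deterministic number $M_p\in\mathbb{C}$. For $m,n\ge0$ with $m+n=p$ put $$c_{mn}^{(p)}=C_k(-\mathrm{i})^m\mathrm{i}^n\frac{(k/2)^p}{m!\,n!}.$$ Assume the leading model $$a_{m,p-m}=c_{m,p-m}^{(p)}M_p+\eta_{m,p-m},\qquad 0\le m\le p,$$ where $\eta_{mn}$ are the Fourier-coefficient errors induced by the far-field noise model described in the context, with noise variance $\sigma_k^2>0$. Then the row estimator and the total-order estimator $$\widehat M_p^{\rm row}=\frac{a_{p,0}}{c_{p,0}^{(p)}},\qquad \widehat M_p^{\rm all}=\frac{\sum_{m=0}^{p}\overline{c_{m,p-m}^{(p)}}\,a_{m,p-m}}{\sum_{m=0}^{p}|c_{m,p-m}^{(p)}|^2}$$ satisfy $$\frac{\operatorname{Var}(\widehat M_p^{\rm row})}{\operatorname{Var}(\widehat M_p^{\rm all})}=\binom{2p}{p}.$$ Equivalently, $$\frac{\operatorname{sd}(\widehat M_p^{\rm row})}{\operatorname{sd}(\widehat M_p^{\rm all})}=\sqrt{\binom{2p}{p}}.$$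
   Context: For a complex random variable $Z$, $\operatorname{Var}(Z)=\mathbb{E}|Z-\mathbb{E}Z|^2$ and $\operatorname{sd}(Z)=\sqrt{\operatorname{Var}(Z)}$. Noise model: the far field is sampled at $\theta_r=2\pi r/N_{\rm ang}$, $\varphi_s=2\pi s/N_{\rm ang}$, $0\le r,s\le N_{\rm ang}-1$, giving a deterministic matrix $U^\infty\in\mathbb{C}^{N_{\rm ang}\times N_{\rm ang}}$. The noisy matrix is $U^\infty_\delta=U^\infty+\delta\|U^\infty\|_F\,W/\|W\|_F$, where $\delta>0$ and $W$ has independent, identically distributed circular (mean-zero) complex Gaussian entries, and $\eta_{mn}$ is the discrete Fourier coefficient of the perturbation: $$\eta_{mn}=\frac{1}{N_{\rm ang}^2}\sum_{r,s=0}^{N_{\rm ang}-1}(U^\infty_\delta-U^\infty)_{rs}\,e^{-2\pi\mathrm{i}mr/N_{\rm ang}}e^{-2\pi\mathrm{i}ns/N_{\rm ang}} .$$ Only orders strictly below the Nyquist index are used, i.e. $p<N_{\rm ang}/2$. The common noise variance is $\sigma_k^2=\delta^2\|U^\infty\|_F^2/N_{\rm ang}^4$. In the application $M_p=\sum_jQ_j\lambda_j^p$ is the leading phase-center moment. *)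

theory Defs
  imports "HOL-Probability.Probability"
begin

definition cvar :: "'a measure \<Rightarrow> ('a \<Rightarrow> complex) \<Rightarrow> real" where
  "cvar M Z = (LINT \<omega>|M. (cmod (Z \<omega> - (LINT \<omega>'|M. Z \<omega>')))\<^sup>2)"

definition csd :: "'a measure \<Rightarrow> ('a \<Rightarrow> complex) \<Rightarrow> real" where
  "csd M Z = sqrt (cvar M Z)"

text \<open>The mean-zero circular law with variance \<open>v\<close> (the expectation of the squared modulus):
  real and imaginary part are independent centred normals, each carrying half of the variance.
  Note that \<open>normal_density\<close> takes the standard deviation.\<close>

definition circular_complex_gaussian :: "'a measure \<Rightarrow> real \<Rightarrow> ('a \<Rightarrow> complex) \<Rightarrow> bool" where
  "circular_complex_gaussian M v Z \<longleftrightarrow>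
     v > 0 \<and>
     distributed M lborel (\<lambda>\<omega>. Re (Z \<omega>)) (normal_density 0 (sqrt (v / 2))) \<and>
     distributed M lborel (\<lambda>\<omega>. Im (Z \<omega>)) (normal_density 0 (sqrt (v / 2))) \<and>
     prob_space.indep_var M borel (\<lambda>\<omega>. Re (Z \<omega>)) borel (\<lambda>\<omega>. Im (Z \<omega>))"

text \<open>An \<open>N \<times> N\<close> matrix is a function of two natural numbers of which only the values at
  indices below \<open>N\<close> are used.\<close>

definition frob_norm :: "nat \<Rightarrow> (nat \<Rightarrow> nat \<Rightarrow> complex) \<Rightarrow> real" where
  "frob_norm N A = sqrt (\<Sum>r<N. \<Sum>s<N. (cmod (A r s))\<^sup>2)"

text \<open>On the event that the matrix \<open>W\<close> vanishes (a null event for Gaussian entries) division by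
  zero makes the perturbation zero.\<close>

definition noisy_matrix ::
    "nat \<Rightarrow> real \<Rightarrow> (nat \<Rightarrow> nat \<Rightarrow> complex) \<Rightarrow> (nat \<Rightarrow> nat \<Rightarrow> complex) \<Rightarrow> nat \<Rightarrow> nat \<Rightarrow> complex" where
  "noisy_matrix N \<delta> U W r s =
     U r s + of_real (\<delta> * frob_norm N U) * (W r s / of_real (frob_norm N W))"

definition dft_coeff :: "nat \<Rightarrow> (nat \<Rightarrow> nat \<Rightarrow> complex) \<Rightarrow> nat \<Rightarrow> nat \<Rightarrow> complex" where
  "dft_coeff N A m n =
     1 / (of_nat N)\<^sup>2 *
     (\<Sum>r<N. \<Sum>s<N. A r s *
        exp (- 2 * of_real pi * \<i> * of_nat m * of_nat r / of_nat N) *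
        exp (- 2 * of_real pi * \<i> * of_nat n * of_nat s / of_nat N))"

definition fourier_error ::
    "nat \<Rightarrow> real \<Rightarrow> (nat \<Rightarrow> nat \<Rightarrow> complex) \<Rightarrow> (nat \<Rightarrow> nat \<Rightarrow> complex) \<Rightarrow> nat \<Rightarrow> nat \<Rightarrow> complex" where
  "fourier_error N \<delta> U W = dft_coeff N (\<lambda>r s. noisy_matrix N \<delta> U W r s - U r s)"

definition noise_variance :: "nat \<Rightarrow> real \<Rightarrow> (nat \<Rightarrow> nat \<Rightarrow> complex) \<Rightarrow> real" where
  "noise_variance N \<delta> U = \<delta>\<^sup>2 * (frob_norm N U)\<^sup>2 / real N ^ 4"

text \<open>The order \<open>p\<close> of the coefficient is \<open>m + n\<close>.\<close>

definition model_coeff :: "complex \<Rightarrow> real \<Rightarrow> nat \<Rightarrow> nat \<Rightarrow> complex" where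
  "model_coeff C k m n =
     C * (- \<i>) ^ m * \<i> ^ n * (of_real (k / 2) ^ (m + n) / (fact m * fact n))"

definition row_estimator :: "complex \<Rightarrow> real \<Rightarrow> nat \<Rightarrow> (nat \<Rightarrow> nat \<Rightarrow> complex) \<Rightarrow> complex" where
  "row_estimator C k p a = a p 0 / model_coeff C k p 0"

definition all_estimator :: "complex \<Rightarrow> real \<Rightarrow> nat \<Rightarrow> (nat \<Rightarrow> nat \<Rightarrow> complex) \<Rightarrow> complex" where
  "all_estimator C k p a =
     (\<Sum>m\<le>p. cnj (model_coeff C k m (p - m)) * a m (p - m)) /
     of_real (\<Sum>m\<le>p. (cmod (model_coeff C k m (p - m)))\<^sup>2)"

end

theory Submission
  imports Defs
begin

text \<open>
  Both estimators equal \<open>Mp\<close> plus a linear combination of the Fourier errors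
  \<open>\<eta>\<^sub>m\<close> of orders \<open>(m, p - m)\<close>; let \<open>c\<^sub>m\<close> be the model coefficient of the same orders. If these errors are uncorrelated with a common
  variance \<open>\<sigma>\<^sup>2\<close>, then the row estimator has variance \<open>\<sigma>\<^sup>2 / |c\<^sub>p|\<^sup>2\<close>
  and the total-order estimator, which is the least-squares estimator, has variance
  \<open>\<sigma>\<^sup>2 / S\<close> with \<open>S = \<Sum>m\<le>p. |c\<^sub>m|\<^sup>2\<close>. The quotient is
  \<open>S / |c\<^sub>p|\<^sup>2\<close>. As \<open>|c\<^sub>m| = |c\<^sub>p| (p choose m)\<close>, this is the sum of the squared
  binomial coefficients of order \<open>p\<close>, that is \<open>(2p choose p)\<close>.

  What has to be shown is that the errors are uncorrelated with equal variances
  (\<open>cvar_fourier_error_combination\<close>). The difficulty is that the noise is normalized by its own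
  random Frobenius norm, so the entries of \<open>W / \<parallel>W\<parallel>\<close> are in general neither Gaussian nor independent.
  Their second moments nevertheless follow from symmetry. The law of \<open>W\<close> is invariant under a sign change
  of one entry, which forces the means and the mixed second moments to vanish; it is invariant under
  swapping two entries, which forces the mean squared moduli to be equal, and these add up to one
  because \<open>W\<close> is almost surely nonzero (\<open>cvar_linear_normalized_vec\<close>). Orthogonality of the discrete
  Fourier characters, whose orders are all below \<open>N\<close>, transfers this from the entries to the
  coefficients (\<open>parseval_antidiagonal\<close>).
\<close>

section \<open>Circular Gaussian laws\<close>

text \<open>The law of a circular Gaussian depends on its variance alone. This is used in two ways: entries
  of equal variance are interchangeable, and, \<open>- X\<close> being circular again, each entry is
  distributed symmetrically about the origin.\<close>

lemma (in prob_space) circular_law: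
  assumes "circular_complex_gaussian M v X"
  shows "distr M borel X =
    distr (density lborel (normal_density 0 (sqrt (v / 2))) \<Otimes>\<^sub>M
           density lborel (normal_density 0 (sqrt (v / 2)))) borel (\<lambda>(x, y). Complex x y)"
proof -
  let ?N = "density lborel (\<lambda>x. ennreal (normal_density 0 (sqrt (v / 2)) x))"
  let ?R = "\<lambda>\<omega>. Re (X \<omega>)" and ?J = "\<lambda>\<omega>. Im (X \<omega>)"
  from assms have R: "distributed M lborel ?R (normal_density 0 (sqrt (v / 2)))"
    and J: "distributed M lborel ?J (normal_density 0 (sqrt (v / 2)))"
    and ind: "indep_var borel ?R borel ?J"
    by (auto simp: circular_complex_gaussian_def)
  have rv [measurable]: "?R \<in> borel_measurable M" "?J \<in> borel_measurable M"
    using ind by (auto dest: indep_var_rv1 indep_var_rv2)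
  have "distr M borel ?R = ?N" "distr M borel ?J = ?N"
    using R J by (auto simp: distributed_def cong: distr_cong)
  then have law: "distr M (borel \<Otimes>\<^sub>M borel) (\<lambda>\<omega>. (?R \<omega>, ?J \<omega>)) = ?N \<Otimes>\<^sub>M ?N"
    using ind by (simp add: indep_var_distribution_eq)
  have [measurable]: "(\<lambda>(x, y). Complex x y) \<in> borel_measurable (borel \<Otimes>\<^sub>M borel)"
    by (simp add: Complex_eq split_beta')
  have "distr M borel X = distr M borel ((\<lambda>(x, y). Complex x y) \<circ> (\<lambda>\<omega>. (?R \<omega>, ?J \<omega>)))"
    by (simp add: comp_def)
  also have "\<dots> = distr (distr M (borel \<Otimes>\<^sub>M borel) (\<lambda>\<omega>. (?R \<omega>, ?J \<omega>))) borel (\<lambda>(x, y). Complex x y)"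
    by (subst distr_distr) auto
  finally show ?thesis
    by (simp add: law)
qed

lemma (in prob_space) circular_uminus:
  assumes "circular_complex_gaussian M v X"
  shows "circular_complex_gaussian M v (\<lambda>\<omega>. - X \<omega>)"
proof -
  have v: "sqrt (v / 2) > 0"
    using assms by (simp add: circular_complex_gaussian_def)
  have neg: "distributed M lborel (\<lambda>\<omega>. - Y \<omega>) (normal_density 0 (sqrt (v / 2)))"
    if "distributed M lborel Y (normal_density 0 (sqrt (v / 2)))" for Y
    using normal_density_affine[OF that v, of "-1" 0] by simp
  have "indep_var borel (uminus \<circ> (\<lambda>\<omega>. Re (X \<omega>))) borel (uminus \<circ> (\<lambda>\<omega>. Im (X \<omega>)))"
    using assms by (intro indep_var_compose) (auto simp: circular_complex_gaussian_def)
  with assms show ?thesis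
    by (auto simp: circular_complex_gaussian_def comp_def intro: neg)
qed

lemma (in prob_space) circular_AE_nonzero:
  assumes "circular_complex_gaussian M v X"
  shows "AE \<omega> in M. X \<omega> \<noteq> 0"
proof -
  have R: "distributed M lborel (\<lambda>\<omega>. Re (X \<omega>)) (normal_density 0 (sqrt (v / 2)))"
    using assms by (simp add: circular_complex_gaussian_def)
  have "AE x in lborel. (0::real) \<noteq> x"
    using AE_lborel_singleton[of "0::real"] by (auto elim: eventually_mono)
  then have "AE x in density lborel (\<lambda>x. ennreal (normal_density 0 (sqrt (v / 2)) x)). x \<noteq> 0"
    by (subst AE_density) auto
  moreover have "distr M lborel (\<lambda>\<omega>. Re (X \<omega>)) =
      density lborel (\<lambda>x. ennreal (normal_density 0 (sqrt (v / 2)) x))"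
    using R by (simp add: distributed_def)
  ultimately have "AE x in distr M lborel (\<lambda>\<omega>. Re (X \<omega>)). x \<noteq> 0"
    by (simp only:)
  moreover have "(\<lambda>\<omega>. Re (X \<omega>)) \<in> measurable M lborel"
    using R by (simp add: distributed_def)
  ultimately have "AE \<omega> in M. Re (X \<omega>) \<noteq> 0"
    by (rule AE_distrD[rotated])
  then show ?thesis
    by eventually_elim auto
qed

section \<open>Symmetries of the joint law\<close>

text \<open>Independence makes the joint law the product of the marginals, so two independent
  families with the same marginals cannot be told apart by expectations. Below the second family is
  the first one with the sign of one entry changed.\<close>

lemma (in prob_space) expectation_indep_same_marginals:
  fixes X Y :: "'i \<Rightarrow> 'a \<Rightarrow> 'b" and F :: "('i \<Rightarrow> 'b) \<Rightarrow> 'c::{banach, second_countable_topology}"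
  assumes "I \<noteq> {}" and X: "indep_vars N X I" and Y: "indep_vars N Y I"
    and marg: "\<And>i. i \<in> I \<Longrightarrow> distr M (N i) (X i) = distr M (N i) (Y i)"
    and F: "F \<in> borel_measurable (Pi\<^sub>M I N)"
  shows "expectation (\<lambda>\<omega>. F (\<lambda>i\<in>I. X i \<omega>)) = expectation (\<lambda>\<omega>. F (\<lambda>i\<in>I. Y i \<omega>))"
proof -
  have rX: "\<And>i. i \<in> I \<Longrightarrow> random_variable (N i) (X i)"
    and rY: "\<And>i. i \<in> I \<Longrightarrow> random_variable (N i) (Y i)"
    using X Y by (auto simp: indep_vars_def)
  have "distr M (Pi\<^sub>M I N) (\<lambda>\<omega>. \<lambda>i\<in>I. X i \<omega>) = distr M (Pi\<^sub>M I N) (\<lambda>\<omega>. \<lambda>i\<in>I. Y i \<omega>)"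
    using X Y indep_vars_iff_distr_eq_PiM'[OF \<open>I \<noteq> {}\<close>, where M' = N and X = X] rX
      indep_vars_iff_distr_eq_PiM'[OF \<open>I \<noteq> {}\<close>, where M' = N and X = Y] rY
    by (simp add: marg cong: PiM_cong)
  moreover have "expectation (\<lambda>\<omega>. F (\<lambda>i\<in>I. Z i \<omega>)) =
      integral\<^sup>L (distr M (Pi\<^sub>M I N) (\<lambda>\<omega>. \<lambda>i\<in>I. Z i \<omega>)) F"
    if "\<And>i. i \<in> I \<Longrightarrow> random_variable (N i) (Z i)" for Z
    using that F by (subst integral_distr) (auto intro!: measurable_restrict)
  ultimately show ?thesis
    using rX rY by simp
qed

text \<open>For identically distributed variables the joint law is a power of one law, and such a product is
  invariant under relabelling of its factors. Below the relabelling swaps two entries.\<close>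

lemma (in prob_space) expectation_iid_reindex:
  fixes X :: "'i \<Rightarrow> 'a \<Rightarrow> 'b" and F :: "('i \<Rightarrow> 'b) \<Rightarrow> 'c::{banach, second_countable_topology}"
  assumes X: "indep_vars (\<lambda>_. N) X I"
    and law: "\<And>i. i \<in> I \<Longrightarrow> distr M N (X i) = D"
    and f: "inj_on f I" "f ` I \<subseteq> I" and "I \<noteq> {}"
    and F: "F \<in> borel_measurable (Pi\<^sub>M I (\<lambda>_. N))"
  shows "expectation (\<lambda>\<omega>. F (\<lambda>i\<in>I. X (f i) \<omega>)) = expectation (\<lambda>\<omega>. F (\<lambda>i\<in>I. X i \<omega>))"
proof -
  let ?P = "Pi\<^sub>M I (\<lambda>_. N)"
  have rX [measurable]: "\<And>i. i \<in> I \<Longrightarrow> random_variable N (X i)"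
    using X by (auto simp: indep_vars_def)
  have fI: "\<And>i. i \<in> I \<Longrightarrow> f i \<in> I"
    using f by auto
  obtain i0 where "i0 \<in> I"
    using \<open>I \<noteq> {}\<close> by auto
  then have D: "prob_space D" "sets D = sets N"
    using law[OF \<open>i0 \<in> I\<close>] rX by (auto intro: prob_space_distr)
  have sets: "sets ?P = sets (Pi\<^sub>M I (\<lambda>_. D))"
    using D by (intro sets_PiM_cong) auto
  have joint: "distr M ?P (\<lambda>\<omega>. \<lambda>i\<in>I. X i \<omega>) = Pi\<^sub>M I (\<lambda>_. D)"
    using X indep_vars_iff_distr_eq_PiM'[OF \<open>I \<noteq> {}\<close>, where M' = "\<lambda>_. N" and X = X] rX
    by (simp add: law cong: PiM_cong)
  have "distr M ?P (\<lambda>\<omega>. \<lambda>i\<in>I. X (f i) \<omega>) =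
      distr M ?P ((\<lambda>x. \<lambda>i\<in>I. x (f i)) \<circ> (\<lambda>\<omega>. \<lambda>i\<in>I. X i \<omega>))"
    using fI by (intro distr_cong) (auto simp: restrict_def fun_eq_iff)
  also have "\<dots> = distr (distr M ?P (\<lambda>\<omega>. \<lambda>i\<in>I. X i \<omega>)) ?P (\<lambda>x. \<lambda>i\<in>I. x (f i))"
    using fI by (subst distr_distr) (auto intro!: measurable_restrict measurable_component_singleton)
  also have "\<dots> = distr (Pi\<^sub>M I (\<lambda>_. D)) (Pi\<^sub>M I (\<lambda>_. D)) (\<lambda>x. \<lambda>i\<in>I. x (f i))"
    unfolding joint using sets by (intro distr_cong) auto
  also have "\<dots> = Pi\<^sub>M I (\<lambda>_. D)"
    using distr_PiM_reindex[of I "\<lambda>_. D" f I] D f fI by auto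
  finally have "distr M ?P (\<lambda>\<omega>. \<lambda>i\<in>I. X (f i) \<omega>) = distr M ?P (\<lambda>\<omega>. \<lambda>i\<in>I. X i \<omega>)"
    by (simp add: joint)
  moreover have "expectation (\<lambda>\<omega>. F (\<lambda>i\<in>I. Z i \<omega>)) =
      integral\<^sup>L (distr M ?P (\<lambda>\<omega>. \<lambda>i\<in>I. Z i \<omega>)) F"
    if "\<And>i. i \<in> I \<Longrightarrow> random_variable N (Z i)" for Z
    using that F by (subst integral_distr) (auto intro!: measurable_restrict)
  ultimately show ?thesis
    using rX fI by simp
qed

section \<open>Moments of the normalized Gaussian vector\<close>

definition normalized_vec :: "'i set \<Rightarrow> ('i \<Rightarrow> complex) \<Rightarrow> 'i \<Rightarrow> complex" where
  "normalized_vec I x i = x i / of_real (sqrt (\<Sum>j\<in>I. (cmod (x j))\<^sup>2))"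

lemma normalized_vec_measurable:
  assumes "i \<in> I"
  shows "(\<lambda>x. normalized_vec I x i) \<in> borel_measurable (Pi\<^sub>M I (\<lambda>_. borel))"
  unfolding normalized_vec_def using assms by measurable

lemma cnj_measurable: "cnj \<in> borel_measurable borel"
  by (intro borel_measurable_continuous_onI continuous_intros)

lemma normalized_vec_cong:
  assumes "\<And>j. j \<in> I \<Longrightarrow> x j = y j" "i \<in> I"
  shows "normalized_vec I x i = normalized_vec I y i"
  using assms by (simp add: normalized_vec_def)

lemma norm_normalized_vec_le:
  assumes "finite I" "i \<in> I"
  shows "cmod (normalized_vec I x i) \<le> 1"
proof -
  have "(cmod (x i))\<^sup>2 \<le> (\<Sum>j\<in>I. (cmod (x j))\<^sup>2)"
    using assms by (intro member_le_sum) auto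
  then have "cmod (x i) \<le> sqrt (\<Sum>j\<in>I. (cmod (x j))\<^sup>2)"
    by (rule real_le_rsqrt)
  then show ?thesis
    by (auto simp: normalized_vec_def norm_divide divide_le_eq_1 sum_nonneg less_le)
qed

text \<open>A nonzero entry excludes the zero vector, which division by zero normalizes to zero instead of to
  a unit vector.\<close>

lemma sum_norm_normalized_vec:
  assumes "finite I" "i \<in> I" "x i \<noteq> 0"
  shows "(\<Sum>j\<in>I. (cmod (normalized_vec I x j))\<^sup>2) = 1"
proof -
  have "(\<Sum>j\<in>I. (cmod (x j))\<^sup>2) > 0"
    using assms by (intro sum_pos2[of _ i]) auto
  then show ?thesis
    by (simp add: normalized_vec_def norm_divide power_divide sum_nonneg flip: sum_divide_distrib)
qed

lemma normalized_vec_flip: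
  assumes "i \<in> I"
  shows "normalized_vec I (\<lambda>l. if l = j then - x l else x l) i =
    (if i = j then - normalized_vec I x i else normalized_vec I x i)"
proof -
  have "(\<Sum>l\<in>I. (cmod (if l = j then - x l else x l))\<^sup>2) = (\<Sum>l\<in>I. (cmod (x l))\<^sup>2)"
    by (intro sum.cong) auto
  then show ?thesis
    by (simp add: normalized_vec_def)
qed

lemma normalized_vec_permute:
  assumes "bij_betw f I I" "i \<in> I"
  shows "normalized_vec I (\<lambda>l. x (f l)) i = normalized_vec I x (f i)"
  using sum.reindex_bij_betw[OF assms(1), of "\<lambda>l. (cmod (x l))\<^sup>2"] by (simp add: normalized_vec_def)

text \<open>In the following \<open>X\<close> is a vector of independent circular Gaussians of equal variance.
  The first and second moments of its normalization are derived from the invariance of the law under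
  sign changes and swaps of the entries.\<close>

context prob_space
begin

context
  fixes I :: "'i set" and X :: "'i \<Rightarrow> 'a \<Rightarrow> complex" and v :: real
  assumes fin: "finite I" and indep: "indep_vars (\<lambda>_. borel) X I"
    and gauss: "\<And>i. i \<in> I \<Longrightarrow> circular_complex_gaussian M v (X i)"
begin

lemma rv_X: "i \<in> I \<Longrightarrow> X i \<in> borel_measurable M"
  using indep by (auto simp: indep_vars_def)

lemma normalized_vec_rv: "i \<in> I \<Longrightarrow> (\<lambda>\<omega>. normalized_vec I (\<lambda>l. X l \<omega>) i) \<in> borel_measurable M"
  unfolding normalized_vec_def using rv_X by measurable

text \<open>Normalized entries have modulus at most one, so that all their moments exist.\<close>

lemma integrable_normalized_vec:
  assumes "i \<in> I" shows "integrable M (\<lambda>\<omega>. normalized_vec I (\<lambda>l. X l \<omega>) i)"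
  using normalized_vec_rv assms norm_normalized_vec_le[OF fin assms]
  by (intro integrable_const_bound[where B = 1]) auto

lemma integrable_normalized_vec_mult:
  assumes "i \<in> I" "j \<in> I"
  shows "integrable M (\<lambda>\<omega>. normalized_vec I (\<lambda>l. X l \<omega>) i * cnj (normalized_vec I (\<lambda>l. X l \<omega>) j))"
  using normalized_vec_rv assms norm_normalized_vec_le[OF fin] 
  by (intro integrable_const_bound[where B = 1] borel_measurable_times)
     (auto simp: norm_mult intro!: mult_le_one measurable_compose[OF _ cnj_measurable])

lemma expectation_flip:
  fixes F :: "('i \<Rightarrow> complex) \<Rightarrow> complex"
  assumes "F \<in> borel_measurable (Pi\<^sub>M I (\<lambda>_. borel))" "j \<in> I"
  shows "expectation (\<lambda>\<omega>. F (\<lambda>i\<in>I. if i = j then - X i \<omega> else X i \<omega>)) =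
    expectation (\<lambda>\<omega>. F (\<lambda>i\<in>I. X i \<omega>))"
proof (rule expectation_indep_same_marginals)
  show "indep_vars (\<lambda>_. borel) (\<lambda>i \<omega>. if i = j then - X i \<omega> else X i \<omega>) I"
    by (rule indep_vars_compose2[OF indep, of "\<lambda>i z. if i = j then - z else z"]) auto
  show "distr M borel (\<lambda>\<omega>. if i = j then - X i \<omega> else X i \<omega>) = distr M borel (X i)"
    if "i \<in> I" for i
    using circular_law[OF gauss[OF that]] circular_law[OF circular_uminus[OF gauss[OF that]]]
    by (cases "i = j") simp_all
qed (use assms indep in auto)

text \<open>Changing the sign of one entry of \<open>X\<close> leaves the norm alone and negates exactly that entry of
  the normalization, so the mean equals its own negative. The same argument applies to the mixed
  second moments, where only one of the two factors changes its sign.\<close>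

lemma expectation_normalized_vec:
  assumes "i \<in> I" shows "expectation (\<lambda>\<omega>. normalized_vec I (\<lambda>l. X l \<omega>) i) = 0"
proof -
  have "expectation (\<lambda>\<omega>. normalized_vec I (\<lambda>l. X l \<omega>) i) =
      expectation (\<lambda>\<omega>. normalized_vec I (\<lambda>l\<in>I. X l \<omega>) i)"
    using assms by (intro Bochner_Integration.integral_cong normalized_vec_cong) auto
  also have "\<dots> = expectation (\<lambda>\<omega>. normalized_vec I (\<lambda>l\<in>I. if l = i then - X l \<omega> else X l \<omega>) i)"
    using expectation_flip[OF normalized_vec_measurable[OF assms] assms] by simp
  also have "\<dots> = expectation (\<lambda>\<omega>. normalized_vec I (\<lambda>l. if l = i then - X l \<omega> else X l \<omega>) i)"
    using assms by (intro Bochner_Integration.integral_cong normalized_vec_cong) auto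
  also have "\<dots> = - expectation (\<lambda>\<omega>. normalized_vec I (\<lambda>l. X l \<omega>) i)"
    using assms by (simp add: normalized_vec_flip)
  finally show ?thesis
    by simp
qed

lemma expectation_normalized_vec_cross:
  assumes "i \<in> I" "j \<in> I" "i \<noteq> j"
  shows "expectation (\<lambda>\<omega>. normalized_vec I (\<lambda>l. X l \<omega>) i * cnj (normalized_vec I (\<lambda>l. X l \<omega>) j)) = 0"
    (is "expectation (\<lambda>\<omega>. ?G (\<lambda>l. X l \<omega>)) = 0")
proof -
  have G: "?G x = ?G y" if "\<And>l. l \<in> I \<Longrightarrow> x l = y l" for x y
    using normalized_vec_cong[of I x y] that assms by simp
  have meas: "?G \<in> borel_measurable (Pi\<^sub>M I (\<lambda>_. borel))"
    using assms
    by (intro borel_measurable_times measurable_compose[OF _ cnj_measurable] normalized_vec_measurable)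
  have "expectation (\<lambda>\<omega>. ?G (\<lambda>l. X l \<omega>)) = expectation (\<lambda>\<omega>. ?G (\<lambda>l\<in>I. X l \<omega>))"
    by (intro Bochner_Integration.integral_cong G) auto
  also have "\<dots> = expectation (\<lambda>\<omega>. ?G (\<lambda>l\<in>I. if l = i then - X l \<omega> else X l \<omega>))"
    using expectation_flip[OF meas assms(1)] by simp
  also have "\<dots> = expectation (\<lambda>\<omega>. ?G (\<lambda>l. if l = i then - X l \<omega> else X l \<omega>))"
    by (intro Bochner_Integration.integral_cong G) auto
  also have "\<dots> = - expectation (\<lambda>\<omega>. ?G (\<lambda>l. X l \<omega>))"
    using assms by (simp add: normalized_vec_flip)
  finally show ?thesis
    by simp
qed

lemma expectation_norm_normalized_vec_eq:
  assumes "i \<in> I" "j \<in> I"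
  shows "expectation (\<lambda>\<omega>. (cmod (normalized_vec I (\<lambda>l. X l \<omega>) i))\<^sup>2) =
    expectation (\<lambda>\<omega>. (cmod (normalized_vec I (\<lambda>l. X l \<omega>) j))\<^sup>2)"
proof -
  define f where "f = Transposition.transpose i j"
  have f: "bij_betw f I I" "f i = j"
    unfolding f_def using assms by (auto simp: bij_betw_transpose_iff)
  have "expectation (\<lambda>\<omega>. (cmod (normalized_vec I (\<lambda>l\<in>I. X (f l) \<omega>) i))\<^sup>2) =
      expectation (\<lambda>\<omega>. (cmod (normalized_vec I (\<lambda>l\<in>I. X l \<omega>) i))\<^sup>2)"
    using f assms normalized_vec_measurable[OF assms(1)] 
    by (intro expectation_iid_reindex[OF indep circular_law[OF gauss],
          where F = "\<lambda>x. (cmod (normalized_vec I x i))\<^sup>2"])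
       (auto simp: bij_betw_def)
  moreover have "normalized_vec I (\<lambda>l\<in>I. X (f l) \<omega>) i = normalized_vec I (\<lambda>l. X l \<omega>) j" for \<omega>
    using normalized_vec_permute[OF f(1) assms(1), of "\<lambda>l. X l \<omega>"]
      normalized_vec_cong[of I "\<lambda>l\<in>I. X (f l) \<omega>" "\<lambda>l. X (f l) \<omega>" i] f assms by simp
  moreover have "normalized_vec I (\<lambda>l\<in>I. X l \<omega>) i = normalized_vec I (\<lambda>l. X l \<omega>) i" for \<omega>
    using assms by (intro normalized_vec_cong) auto
  ultimately show ?thesis
    by simp
qed

text \<open>The squared moduli of the normalized entries add up to one almost surely and have equal means by
  the swap symmetry, so that each mean is an equal share of one.\<close>

lemma expectation_norm_normalized_vec:
  assumes "i \<in> I"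
  shows "expectation (\<lambda>\<omega>. (cmod (normalized_vec I (\<lambda>l. X l \<omega>) i))\<^sup>2) = 1 / card I"
proof -
  let ?V = "\<lambda>i \<omega>. (cmod (normalized_vec I (\<lambda>l. X l \<omega>) i))\<^sup>2"
  have int: "integrable M (?V j)" if "j \<in> I" for j
    using normalized_vec_rv[OF that] norm_normalized_vec_le[OF fin that]
    by (intro integrable_const_bound[where B = 1]) (auto simp: power_le_one)
  have "AE \<omega> in M. (\<Sum>j\<in>I. ?V j \<omega>) = 1"
    using circular_AE_nonzero[OF gauss[OF assms]] sum_norm_normalized_vec[OF fin assms]
    by (auto elim!: eventually_mono)
  then have "expectation (\<lambda>\<omega>. \<Sum>j\<in>I. ?V j \<omega>) = expectation (\<lambda>_. 1)"
    using normalized_vec_rv by (intro integral_cong_AE) auto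
  also have "\<dots> = 1"
    by (simp add: prob_space)
  finally have "(\<Sum>j\<in>I. expectation (?V j)) = 1"
    using int by simp
  moreover have "(\<Sum>j\<in>I. expectation (?V j)) = (\<Sum>j\<in>I. expectation (?V i))"
    using assms by (intro sum.cong expectation_norm_normalized_vec_eq) auto
  moreover have "card I > 0"
    using assms fin by (auto simp: card_gt_0_iff)
  ultimately show ?thesis
    by (simp add: field_simps)
qed

text \<open>Dividing by the random norm makes the entries dependent, but they remain uncorrelated. Variances
  of linear combinations are therefore computed as for independent entries.\<close>

lemma cvar_linear_normalized_vec:
  "cvar M (\<lambda>\<omega>. c + (\<Sum>i\<in>I. g i * normalized_vec I (\<lambda>l. X l \<omega>) i)) = (\<Sum>i\<in>I. (cmod (g i))\<^sup>2) / card I"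
proof -
  let ?V = "\<lambda>i \<omega>. normalized_vec I (\<lambda>l. X l \<omega>) i"
  let ?Z = "\<lambda>\<omega>. \<Sum>i\<in>I. g i * ?V i \<omega>"
  have mean: "expectation (\<lambda>\<omega>. c + ?Z \<omega>) = c"
    using integrable_normalized_vec expectation_normalized_vec by (simp add: prob_space)
  have second: "expectation (\<lambda>\<omega>. ?V i \<omega> * cnj (?V j \<omega>)) = (if i = j then of_real (1 / card I) else 0)"
    if "i \<in> I" "j \<in> I" for i j
    using that expectation_normalized_vec_cross[of i j] expectation_norm_normalized_vec[of i]
    by (auto simp: complex_norm_square[symmetric] simp del: of_real_power)
  have "complex_of_real (cvar M (\<lambda>\<omega>. c + ?Z \<omega>)) = expectation (\<lambda>\<omega>. ?Z \<omega> * cnj (?Z \<omega>))"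
    unfolding cvar_def mean 
    by (simp add: complex_norm_square[symmetric] flip: integral_complex_of_real del: of_real_power cnj_sum)
  also have "\<dots> = expectation (\<lambda>\<omega>. \<Sum>i\<in>I. \<Sum>j\<in>I. (g i * cnj (g j)) * (?V i \<omega> * cnj (?V j \<omega>)))"
    by (simp add: sum_product mult_ac)
  also have "\<dots> = (\<Sum>i\<in>I. \<Sum>j\<in>I. (g i * cnj (g j)) * expectation (\<lambda>\<omega>. ?V i \<omega> * cnj (?V j \<omega>)))"
    using integrable_normalized_vec_mult by simp
  also have "\<dots> = (\<Sum>i\<in>I. \<Sum>j\<in>I. if i = j then (g i * cnj (g i)) * of_real (1 / card I) else 0)"
    using second by (intro sum.cong) auto
  also have "\<dots> = of_real ((\<Sum>i\<in>I. (cmod (g i))\<^sup>2) / card I)"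
    using fin by (simp add: sum_divide_distrib complex_norm_square[symmetric] del: of_real_power)
  finally show ?thesis
    by (simp only: of_real_eq_iff)
qed

end

end

section \<open>Discrete Fourier characters\<close>

definition dft_char :: "nat \<Rightarrow> nat \<Rightarrow> nat \<Rightarrow> complex" where
  "dft_char N m r = exp (- 2 * of_real pi * \<i> * of_nat m * of_nat r / of_nat N)"

lemma dft_char_eq: "dft_char N m r = cis (- 2 * pi * real m / real N) ^ r"
proof -
  have "dft_char N m r = exp (of_nat r * (\<i> * of_real (- 2 * pi * real m / real N)))"
    unfolding dft_char_def by (rule arg_cong[of _ _ exp]) simp
  then show ?thesis
    by (simp only: exp_of_nat_mult cis_conv_exp)
qed

text \<open>The product is a power of the root of unity \<open>cis t\<close>, and the sum over a full period of the
  powers of a nontrivial root of unity vanishes. The root is nontrivial because two different orders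
  below \<open>N\<close> are incongruent modulo \<open>N\<close>.\<close>

lemma dft_char_orthogonal:
  assumes "m < N" "m' < N"
  shows "(\<Sum>r<N. dft_char N m r * cnj (dft_char N m' r)) = (if m = m' then of_nat N else 0)"
proof -
  define t where "t = 2 * pi * (real m' - real m) / real N"
  have N: "real N > 0"
    using assms by simp
  have char: "dft_char N m r * cnj (dft_char N m' r) = cis t ^ r" for r
  proof -
    have "dft_char N m r * cnj (dft_char N m' r) =
        (cis (- 2 * pi * real m / real N) * cis (2 * pi * real m' / real N)) ^ r"
      by (simp add: dft_char_eq power_mult_distrib cis_cnj)
    also have "cis (- 2 * pi * real m / real N) * cis (2 * pi * real m' / real N) = cis t"
      unfolding cis_mult t_def by (rule arg_cong[of _ _ cis]) (simp add: diff_divide_distrib algebra_simps)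
    finally show ?thesis .
  qed
  show ?thesis
  proof (cases "m = m'")
    case True
    then show ?thesis
      unfolding char by (simp add: t_def)
  next
    case False
    have "cis t \<noteq> 1"
    proof
      assume "cis t = 1"
      then have "cos t = 1"
        by (metis cis.sel(1) one_complex.sel(1))
      then obtain n :: int where "t = of_int n * 2 * pi"
        by (auto simp: cos_one_2pi_int)
      then have "(2 * pi) * (real m' - real m) = (2 * pi) * (of_int n * real N)"
        using N by (simp add: t_def field_simps)
      then have "real m' - real m = of_int n * real N"
        by (metis mult_cancel_left mult_eq_0_iff pi_neq_zero zero_neq_numeral)
      then have "real_of_int (int m' - int m) = real_of_int (n * int N)"
        by simp
      then have "int m' - int m = n * int N"
        by (simp only: of_int_eq_iff)
      then have "int N dvd int m' - int m"
        by simp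
      with False have "int N \<le> \<bar>int m' - int m\<bar>"
        by (intro zdvd_imp_le) (auto simp: dvd_abs_iff)
      with assms show False
        by linarith
    qed
    moreover have "cis t ^ N = 1"
    proof -
      have "cis t ^ N = cis (2 * pi * of_int (int m' - int m))"
        unfolding Complex.DeMoivre t_def using N by (intro arg_cong[of _ _ cis]) simp
      also have "\<dots> = 1"
        by (rule cis_multiple_2pi) simp
      finally show ?thesis .
    qed
    ultimately show ?thesis
      using False unfolding char by (simp add: geometric_sum)
  qed
qed

text \<open>Parseval's identity for the two-dimensional characters with orders \<open>(m, p - m)\<close>: after expansion
  of the squared modulus the double sum factors into two one-dimensional sums, and orthogonality
  of the characters leaves only the diagonal terms.\<close>

lemma parseval_antidiagonal:
  fixes b :: "nat \<Rightarrow> complex"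
  assumes "p < N"
  shows "(\<Sum>(r, s) \<in> {..<N} \<times> {..<N}. (cmod (\<Sum>m\<le>p. b m * (dft_char N m r * dft_char N (p - m) s)))\<^sup>2) =
    (real N)\<^sup>2 * (\<Sum>m\<le>p. (cmod (b m))\<^sup>2)"
proof -
  let ?e = "dft_char N"
  have "complex_of_real (\<Sum>(r, s) \<in> {..<N} \<times> {..<N}. (cmod (\<Sum>m\<le>p. b m * (?e m r * ?e (p - m) s)))\<^sup>2) =
      (\<Sum>r<N. \<Sum>s<N. \<Sum>m\<le>p. \<Sum>m'\<le>p. (b m * (?e m r * ?e (p - m) s)) *
         cnj (b m' * (?e m' r * ?e (p - m') s)))"
    by (simp only: of_real_sum sum.cartesian_product[symmetric] complex_norm_square cnj_sum sum_product)
  also have "\<dots> = (\<Sum>r<N. \<Sum>m\<le>p. \<Sum>m'\<le>p. \<Sum>s<N. (b m * cnj (b m')) *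
         ((?e m r * cnj (?e m' r)) * (?e (p - m) s * cnj (?e (p - m') s))))"
    by (subst sum.swap, subst sum.swap[of _ "{..<N}"]) (simp add: mult_ac)
  also have "\<dots> = (\<Sum>m\<le>p. \<Sum>m'\<le>p. \<Sum>r<N. \<Sum>s<N. (b m * cnj (b m')) *
         ((?e m r * cnj (?e m' r)) * (?e (p - m) s * cnj (?e (p - m') s))))"
    by (subst sum.swap, subst sum.swap[of _ "{..<N}"]) simp
  also have "\<dots> = (\<Sum>m\<le>p. \<Sum>m'\<le>p. (b m * cnj (b m')) *
         ((\<Sum>r<N. ?e m r * cnj (?e m' r)) * (\<Sum>s<N. ?e (p - m) s * cnj (?e (p - m') s))))"
    unfolding sum_product by (simp only: sum_distrib_left)
  also have "\<dots> = (\<Sum>m\<le>p. \<Sum>m'\<le>p. if m = m' then (b m * cnj (b m)) * (of_nat N)\<^sup>2 else 0)"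
    using assms by (intro sum.cong) (auto simp: dft_char_orthogonal power2_eq_square)
  also have "\<dots> = of_real ((real N)\<^sup>2 * (\<Sum>m\<le>p. (cmod (b m))\<^sup>2))"
    by (simp add: sum_distrib_left mult_ac complex_norm_square[symmetric] del: of_real_power)
       (simp add: complex_norm_square mult_ac)
  finally show ?thesis
    by (simp only: of_real_eq_iff)
qed

text \<open>With the pairs of indices as coordinates, the Frobenius norm is a Euclidean norm. A Fourier error is
  therefore a linear form in a normalized Gaussian vector, to which \<open>cvar_linear_normalized_vec\<close>
  applies.\<close>

lemma fourier_error_eq_normalized_vec:
  "fourier_error N \<delta> U W m n = (\<Sum>(r, s) \<in> {..<N} \<times> {..<N}.
     of_real (\<delta> * frob_norm N U) / (of_nat N)\<^sup>2 * (dft_char N m r * dft_char N n s) *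
     normalized_vec ({..<N} \<times> {..<N}) (\<lambda>(r, s). W r s) (r, s))"
proof -
  have "frob_norm N W = sqrt (\<Sum>j\<in>{..<N} \<times> {..<N}. (cmod (case j of (r, s) \<Rightarrow> W r s))\<^sup>2)"
    by (simp add: frob_norm_def sum.cartesian_product split_beta')
  then show ?thesis
    unfolding fourier_error_def dft_coeff_def dft_char_def noisy_matrix_def normalized_vec_def
    by (simp add: sum.cartesian_product[symmetric] sum_distrib_left mult_ac)
qed

text \<open>The Fourier errors on an antidiagonal are uncorrelated with common variance
  \<open>noise_variance N \<delta> U\<close>: the normalized noise entries are uncorrelated with variance
  \<open>1 / N\<^sup>2\<close>, and orthogonality of the characters carries this over to the coefficients.
  Parseval's factor \<open>N\<^sup>2\<close> cancels against this variance.\<close>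

lemma cvar_fourier_error_combination:
  fixes W :: "nat \<Rightarrow> nat \<Rightarrow> 'a \<Rightarrow> complex"
  assumes "prob_space M" and p: "p < N"
    and indep: "prob_space.indep_vars M (\<lambda>_. borel) (\<lambda>(r, s). W r s) ({..<N} \<times> {..<N})"
    and gauss: "\<And>r s. r < N \<Longrightarrow> s < N \<Longrightarrow> circular_complex_gaussian M v (W r s)"
  shows "cvar M (\<lambda>\<omega>. c + (\<Sum>m\<le>p. b m * fourier_error N \<delta> U (\<lambda>r s. W r s \<omega>) m (p - m))) =
    noise_variance N \<delta> U * (\<Sum>m\<le>p. (cmod (b m))\<^sup>2)"
proof -
  interpret prob_space M by fact
  let ?I = "{..<N} \<times> {..<N}"
  let ?K = "complex_of_real (\<delta> * frob_norm N U) / (of_nat N)\<^sup>2"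
  let ?X = "\<lambda>(r, s). W r s"
  define g where "g = (\<lambda>(r, s). ?K * (\<Sum>m\<le>p. b m * (dft_char N m r * dft_char N (p - m) s)))"
  have "(\<Sum>m\<le>p. b m * fourier_error N \<delta> U (\<lambda>r s. W r s \<omega>) m (p - m)) =
      (\<Sum>i\<in>?I. g i * normalized_vec ?I (\<lambda>l. ?X l \<omega>) i)" for \<omega>
  proof -
    have X: "(\<lambda>l. ?X l \<omega>) = (\<lambda>(r, s). W r s \<omega>)"
      by auto
    show ?thesis
      unfolding fourier_error_eq_normalized_vec sum_distrib_left X
      by (subst sum.swap) (auto simp: g_def sum_distrib_left sum_distrib_right mult_ac intro!: sum.cong)
  qed
  then have "cvar M (\<lambda>\<omega>. c + (\<Sum>m\<le>p. b m * fourier_error N \<delta> U (\<lambda>r s. W r s \<omega>) m (p - m))) =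
      (\<Sum>i\<in>?I. (cmod (g i))\<^sup>2) / card ?I"
    using cvar_linear_normalized_vec[of ?I ?X v c g] indep gauss by auto
  also have "(\<Sum>i\<in>?I. (cmod (g i))\<^sup>2) = (cmod ?K)\<^sup>2 *
      (\<Sum>(r, s)\<in>?I. (cmod (\<Sum>m\<le>p. b m * (dft_char N m r * dft_char N (p - m) s)))\<^sup>2)"
    unfolding sum_distrib_left
    by (intro sum.cong) (auto simp: g_def norm_mult norm_divide power_mult_distrib power_divide)
  also have "\<dots> = (cmod ?K)\<^sup>2 * ((real N)\<^sup>2 * (\<Sum>m\<le>p. (cmod (b m))\<^sup>2))"
    unfolding parseval_antidiagonal[OF p] ..
  also have "(cmod ?K)\<^sup>2 = noise_variance N \<delta> U"
    by (simp add: noise_variance_def norm_divide norm_mult norm_power power_divide power_mult_distrib)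
  finally show ?thesis
    using p by (simp add: power2_eq_square)
qed

section \<open>The two estimators\<close>

lemma cvar_cong:
  assumes "\<And>\<omega>. \<omega> \<in> space M \<Longrightarrow> Z \<omega> = Z' \<omega>"
  shows "cvar M Z = cvar M Z'"
proof -
  have "(LINT \<omega>|M. Z \<omega>) = (LINT \<omega>|M. Z' \<omega>)"
    using assms by (intro Bochner_Integration.integral_cong) auto
  then show ?thesis
    unfolding cvar_def using assms by (intro Bochner_Integration.integral_cong) auto
qed

text \<open>Up to a factor that is the same for all \<open>m\<close>, the modulus is \<open>1 / (m! (p - m)!)\<close>, which is
  a binomial coefficient divided by \<open>p!\<close>. The sum of squares in the next lemma is then the
  Vandermonde sum of the squared binomial coefficients.\<close>

lemma norm_model_coeff:
  assumes "k > 0" "m \<le> p"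
  shows "cmod (model_coeff C k m (p - m)) = cmod (model_coeff C k p 0) * real (p choose m)"
  using assms by (simp add: model_coeff_def norm_mult norm_divide norm_power binomial_fact)

lemma sum_norm_model_coeff:
  assumes "k > 0"
  shows "(\<Sum>m\<le>p. (cmod (model_coeff C k m (p - m)))\<^sup>2) =
    (cmod (model_coeff C k p 0))\<^sup>2 * real ((2 * p) choose p)"
proof -
  have "(\<Sum>m\<le>p. (cmod (model_coeff C k m (p - m)))\<^sup>2) =
      (\<Sum>m\<le>p. (cmod (model_coeff C k p 0))\<^sup>2 * real ((p choose m)\<^sup>2))"
    using assms by (intro sum.cong) (auto simp: norm_model_coeff power_mult_distrib)
  then show ?thesis
    by (simp only: choose_square_sum flip: sum_distrib_left of_nat_sum)
qed

theorem theorem3p2: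
  fixes M :: "'a measure"
    and k \<delta> v :: real
    and C Mp :: complex
    and p N :: nat
    and U :: "nat \<Rightarrow> nat \<Rightarrow> complex"
    and W a :: "nat \<Rightarrow> nat \<Rightarrow> 'a \<Rightarrow> complex"
  assumes "prob_space M"
    and "k > 0" and "C \<noteq> 0"
    and "real p < real N / 2"
    and "\<delta> > 0" and "noise_variance N \<delta> U > 0"
    and W_indep: "prob_space.indep_vars M (\<lambda>_. borel) (\<lambda>(r, s). W r s) ({..<N} \<times> {..<N})"
    and W_gaussian: "\<And>r s. r < N \<Longrightarrow> s < N \<Longrightarrow> circular_complex_gaussian M v (W r s)"
    and model: "\<And>m \<omega>. m \<le> p \<Longrightarrow> \<omega> \<in> space M \<Longrightarrow>
      a m (p - m) \<omega> =
        model_coeff C k m (p - m) * Mp + fourier_error N \<delta> U (\<lambda>r s. W r s \<omega>) m (p - m)"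
  shows "cvar M (\<lambda>\<omega>. row_estimator C k p (\<lambda>m n. a m n \<omega>)) /
           cvar M (\<lambda>\<omega>. all_estimator C k p (\<lambda>m n. a m n \<omega>)) = real ((2 * p) choose p)
       \<and> csd M (\<lambda>\<omega>. row_estimator C k p (\<lambda>m n. a m n \<omega>)) /
           csd M (\<lambda>\<omega>. all_estimator C k p (\<lambda>m n. a m n \<omega>)) = sqrt (real ((2 * p) choose p))"
proof -
  let ?c = "\<lambda>m. model_coeff C k m (p - m)"
  let ?\<eta> = "\<lambda>\<omega> m. fourier_error N \<delta> U (\<lambda>r s. W r s \<omega>) m (p - m)"
  let ?row = "\<lambda>\<omega>. row_estimator C k p (\<lambda>m n. a m n \<omega>)"
  let ?all = "\<lambda>\<omega>. all_estimator C k p (\<lambda>m n. a m n \<omega>)"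
  define S where "S = (\<Sum>m\<le>p. (cmod (?c m))\<^sup>2)"
  have cp: "?c p \<noteq> 0"
    using \<open>k > 0\<close> \<open>C \<noteq> 0\<close> by (simp add: model_coeff_def)
  have S: "S = (cmod (?c p))\<^sup>2 * real ((2 * p) choose p)"
    using sum_norm_model_coeff[OF \<open>k > 0\<close>] by (simp add: S_def)
  with cp have "S > 0"
    by simp
  have "p < N"
    using \<open>real p < real N / 2\<close> by linarith
  note var = cvar_fourier_error_combination[OF \<open>prob_space M\<close> \<open>p < N\<close> W_indep W_gaussian,
      where \<delta> = \<delta> and U = U]
  \<comment> \<open>Both estimators are \<open>Mp\<close> plus a fixed combination of the Fourier errors; the row estimator
    puts its whole weight on \<open>m = p\<close>.\<close>
  have row: "?row \<omega> = Mp + (\<Sum>m\<le>p. (if m = p then 1 / ?c p else 0) * ?\<eta> \<omega> m)"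
    if "\<omega> \<in> space M" for \<omega>
    using model[OF order_refl that] cp
    by (simp add: row_estimator_def add_divide_distrib if_distrib[of "\<lambda>x. x * _"] cong: if_cong)
  have "cvar M ?row = cvar M (\<lambda>\<omega>. Mp + (\<Sum>m\<le>p. (if m = p then 1 / ?c p else 0) * ?\<eta> \<omega> m))"
    using row by (rule cvar_cong)
  also have "\<dots> = noise_variance N \<delta> U * (\<Sum>m\<le>p. (cmod (if m = p then 1 / ?c p else 0))\<^sup>2)"
    by (rule var)
  also have "(\<Sum>m\<le>p. (cmod (if m = p then 1 / ?c p else 0))\<^sup>2) =
      (\<Sum>m\<le>p. if m = p then 1 / (cmod (?c p))\<^sup>2 else 0)"
    by (intro sum.cong) (auto simp: norm_divide power_divide)
  finally have var_row: "cvar M ?row = noise_variance N \<delta> U / (cmod (?c p))\<^sup>2"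
    by simp
  have all: "?all \<omega> = Mp + (\<Sum>m\<le>p. cnj (?c m) / of_real S * ?\<eta> \<omega> m)"
    if "\<omega> \<in> space M" for \<omega>
  proof -
    \<comment> \<open>The conjugate weights turn the signal part into \<open>S * Mp\<close>, so that the normalization
      by \<open>S\<close> makes the estimator unbiased.\<close>
    have "(\<Sum>m\<le>p. cnj (?c m) * a m (p - m) \<omega>) = (\<Sum>m\<le>p. of_real ((cmod (?c m))\<^sup>2) * Mp + cnj (?c m) * ?\<eta> \<omega> m)"
      unfolding complex_norm_square using model that by (intro sum.cong) (auto simp: algebra_simps)
    also have "\<dots> = of_real S * Mp + (\<Sum>m\<le>p. cnj (?c m) * ?\<eta> \<omega> m)"
      by (simp only: S_def sum.distrib of_real_sum sum_distrib_right)
    finally show ?thesis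
      using \<open>S > 0\<close> unfolding all_estimator_def S_def[symmetric]
      by (simp add: add_divide_distrib sum_divide_distrib)
  qed
  have "cvar M ?all = cvar M (\<lambda>\<omega>. Mp + (\<Sum>m\<le>p. cnj (?c m) / of_real S * ?\<eta> \<omega> m))"
    using all by (rule cvar_cong)
  also have "\<dots> = noise_variance N \<delta> U * (\<Sum>m\<le>p. (cmod (cnj (?c m) / of_real S))\<^sup>2)"
    by (rule var)
  also have "(\<Sum>m\<le>p. (cmod (cnj (?c m) / of_real S))\<^sup>2) = S / S\<^sup>2"
    unfolding S_def[symmetric] by (simp add: norm_divide power_divide flip: sum_divide_distrib S_def)
  finally have var_all: "cvar M ?all = noise_variance N \<delta> U / S"
    using \<open>S > 0\<close> by (simp add: power2_eq_square)
  have ratio: "cvar M ?row / cvar M ?all = real ((2 * p) choose p)"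
    using \<open>noise_variance N \<delta> U > 0\<close> cp unfolding var_row var_all S by simp
  then show ?thesis
    by (simp add: csd_def flip: real_sqrt_divide)
qed

end
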